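(* Let $X$ be a finite set with $|X|=n$ and let $R$ be a strict order relation on $X$ such that the poset $[X,R]$ does not contain subposets isomorphic to $\mathbf{2}+\mathbf{2}$ or $Z_4$. Then $[X,R]\in\mathbf{R}(n)$, i.e. there exists a binary relation $S$ on $X$ such that $(S,R)$ is a Catalan pair on $X$.
   Context: For a finite set $X$, let $\mathcal{D}=\{(x,x)\mid x\in X\}$; for a binary relation $\theta$ on $X$ let $\overline{\theta}=\theta\cup\theta^{-1}$; for binary relations $A,B$ on $X$, $A\circ B=\{(x,z)\mid \exists y\in X:\ xAy \text{ and } yBz\}$. Let $\mathcal{O}(X)$ be the set of strict order relations on $X$ (irreflexive and transitive binary relations). A Catalan pair on $X$ is an ordered pair $(S,R)$ of binary relations on $X$ such that: (ord S) $S\in\mathcal{O}(X)$; (ord R) $R\in\mathcal{O}(X)$; (tot) $\overline{R}\cup\overline{S}=X^2\setminus\mathcal{D}$; (inters) $\overline{R}\cap\overline{S}=\emptyset$; (comp) $S\circ R\subseteq R$. $[X,R]$ denotes the poset on $X$ with strict order $R$. $\mathbf{R}(n)$ is the set of posets $[X,R]$ with $|X|=n$ for which there exists $S$ such that $(S,R)$ is a Catalan pair on $X$. A subposet is a subset with the induced order. $\mathbf{2}+\mathbf{2}$ is the disjoint union (direct sum) of two 2-element chains: four elements $x,y,z,t$ whose only order relations are $x<y$ and $z<t$. $Z_4$ (the fence of order 4) has four elements $x,y,z,t$ whose only order relations are $x<y$, $x<t$, $z<t$. *)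

theory Defs
  imports Main
begin

definition strict_orders :: "'a set \<Rightarrow> 'a rel set" where
  "strict_orders X = {R. R \<subseteq> X \<times> X \<and> irrefl R \<and> trans R}"

definition sym_closure :: "'a rel \<Rightarrow> 'a rel" where
  "sym_closure R = R \<union> R\<inverse>"

(* Relation composition A \<circ> B, read left to right as usual in order theory,
   is the library's A O B. *)

definition catalan_pair :: "'a set \<Rightarrow> 'a rel \<Rightarrow> 'a rel \<Rightarrow> bool" where
  "catalan_pair X S R \<longleftrightarrow>
     S \<in> strict_orders X \<and>
     R \<in> strict_orders X \<and>
     sym_closure R \<union> sym_closure S = X \<times> X - Id_on X \<and>
     sym_closure R \<inter> sym_closure S = {} \<and>
     S O R \<subseteq> R"

(* A poset [X, R] is represented by the pair of its carrier and its strict order. The carrier has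
   to be recorded, since the isolated points of the poset do not lie in Field R. *)

definition catalan_posets :: "nat \<Rightarrow> ('a set \<times> 'a rel) set" where
  "catalan_posets n =
     {(X, R). finite X \<and> card X = n \<and> (\<exists>S. catalan_pair X S R)}"

definition poset_iso :: "'a set \<times> 'a rel \<Rightarrow> 'b set \<times> 'b rel \<Rightarrow> bool" where
  "poset_iso P Q \<longleftrightarrow>
     (\<exists>f. bij_betw f (fst P) (fst Q) \<and>
          (\<forall>x\<in>fst P. \<forall>y\<in>fst P. (x, y) \<in> snd P \<longleftrightarrow> (f x, f y) \<in> snd Q))"

definition subposet :: "'a set \<times> 'a rel \<Rightarrow> 'a set \<Rightarrow> 'a set \<times> 'a rel" where
  "subposet P Y = (Y, snd P \<inter> Y \<times> Y)"

definition contains_subposet_iso :: "'a set \<times> 'a rel \<Rightarrow> 'b set \<times> 'b rel \<Rightarrow> bool" where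
  "contains_subposet_iso P Q \<longleftrightarrow> (\<exists>Y \<subseteq> fst P. poset_iso (subposet P Y) Q)"

(* In both four-element posets the elements x, y, z, t are 0, 1, 2, 3. *)

definition two_plus_two :: "nat set \<times> nat rel" where
  "two_plus_two = ({0, 1, 2, 3}, {(0, 1), (2, 3)})"

definition fence4 :: "nat set \<times> nat rel" where
  "fence4 = ({0, 1, 2, 3}, {(0, 1), (0, 3), (2, 3)})"

end

theory Submission
  imports Defs
begin

text \<open>
  In a Catalan pair the condition \<open>S O R \<subseteq> R\<close> says that \<open>S\<close> may only point from \<open>x\<close> to \<open>y\<close> when
  every strict upper bound of \<open>y\<close> is one of \<open>x\<close>, and the remaining conditions say that \<open>S\<close> is a
  strict order orienting exactly the pairs of distinct \<open>R\<close>-incomparable elements. Absence of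
  \<open>2 + 2\<close> makes the up-sets of any two elements nested (\<open>interval_order\<close>), so orienting a pair
  towards the smaller up-set is the natural choice; ties have to be broken so that the result stays
  transitive.

  Ties are broken by the down-sets, which are nested for the same reason, and then by an arbitrary
  injective numbering. Since nested finite sets are compared by their cardinalities, this is the
  lexicographic order on triples of natural numbers, restricted to incomparable pairs. The only
  way transitivity can fail is that \<open>x\<close>, \<open>y\<close> and \<open>y\<close>, \<open>z\<close> are oriented forwards while \<open>x\<close>, \<open>z\<close>
  are comparable. A relation \<open>z < x\<close> would make the up-set of \<open>z\<close> larger than that of \<open>x\<close>. If
  \<open>x < z\<close> and the up-set of \<open>z\<close> is strictly smaller than that of \<open>y\<close>, any \<open>t\<close> in the difference
  yields the fence \<open>z > x < t > y\<close>. If the two up-sets agree, the tie-breaking rule puts \<open>x\<close>,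
  which lies below \<open>z\<close>, below \<open>y\<close> as well.
\<close>

lemma contains_subposet_iso_four:
  assumes "distinct [x, y, z, t]" and "{x, y, z, t} \<subseteq> X"
    and "\<And>i j. i < 4 \<Longrightarrow> j < 4 \<Longrightarrow> ([x, y, z, t] ! i, [x, y, z, t] ! j) \<in> R \<longleftrightarrow> (i, j) \<in> Q"
  shows "contains_subposet_iso (X, R) ({0, 1, 2, 3 :: nat}, Q)"
proof -
  let ?g = "\<lambda>i. [x, y, z, t] ! i"
  let ?I = "{0, 1, 2, 3 :: nat}"
  have I: "?I = {..<4}"
    by auto
  have bij: "bij_betw ?g ?I {x, y, z, t}"
    unfolding bij_betw_def
  proof
    show "inj_on ?g ?I"
      unfolding I using assms(1) by (intro inj_on_nth) auto
    show "?g ` ?I = {x, y, z, t}"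
      by (auto simp: numeral_eq_Suc)
  qed
  let ?f = "inv_into ?I ?g"
  have f: "?f u < 4" "?g (?f u) = u" if "u \<in> {x, y, z, t}" for u
    using bij_betwE[OF bij_betw_inv_into[OF bij]] bij_betw_inv_into_right[OF bij] that
    unfolding I by blast+
  have "(u, v) \<in> R \<longleftrightarrow> (?f u, ?f v) \<in> Q"
    if "u \<in> {x, y, z, t}" "v \<in> {x, y, z, t}" for u v
    using assms(3)[of "?f u" "?f v"] f[OF that(1)] f[OF that(2)] by metis
  then show ?thesis
    unfolding contains_subposet_iso_def poset_iso_def subposet_def
    using bij_betw_inv_into[OF bij] assms(2)
    by (intro exI[of _ "{x, y, z, t}"]) auto
qed

text \<open>If both relations failed, the two chains \<open>x < u\<close> and \<open>y < v\<close> would form \<open>2 + 2\<close>: any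
  coincidence or relation between the chains gives one of the two missing relations by
  transitivity.\<close>

lemma interval_order:
  assumes R: "R \<in> strict_orders X"
    and free: "\<not> contains_subposet_iso (X, R) two_plus_two"
    and xu: "(x, u) \<in> R" and yv: "(y, v) \<in> R"
  shows "(x, v) \<in> R \<or> (y, u) \<in> R"
proof (rule ccontr)
  assume contra: "\<not> ((x, v) \<in> R \<or> (y, u) \<in> R)"
  have irr: "(a, a) \<notin> R" for a
    using R by (auto simp: strict_orders_def irrefl_def)
  have tr: "(a, b) \<in> R \<Longrightarrow> (b, c) \<in> R \<Longrightarrow> (a, c) \<in> R" for a b c
    using R by (auto simp: strict_orders_def dest: transD)
  have sub: "{x, u, y, v} \<subseteq> X"
    using R xu yv by (auto simp: strict_orders_def)
  have dist: "distinct [x, u, y, v]"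
    using irr contra xu yv tr by auto
  have neg: "(u, x) \<notin> R" "(x, y) \<notin> R" "(y, x) \<notin> R" "(u, y) \<notin> R" "(u, v) \<notin> R" "(v, u) \<notin> R"
    "(v, x) \<notin> R" "(v, y) \<notin> R"
    using irr contra xu yv tr by metis+
  have "([x, u, y, v] ! i, [x, u, y, v] ! j) \<in> R \<longleftrightarrow> (i, j) \<in> {(0, 1), (2, 3)}"
    if "i < 4" "j < 4" for i j :: nat
    using that neg irr contra xu yv by (auto simp: numeral_eq_Suc less_Suc_eq)
  from contains_subposet_iso_four[OF dist sub this] free show False
    by (simp add: two_plus_two_def)
qed

text \<open>Here \<open>z > x < t > y\<close> is the candidate fence. The relations \<open>y < z\<close>, \<open>x < y\<close> and \<open>z < t\<close> are
  the ones that can spoil it: any other coincidence or extra relation implies one of these or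
  contradicts irreflexivity.\<close>

lemma fence_free:
  assumes R: "R \<in> strict_orders X"
    and free: "\<not> contains_subposet_iso (X, R) fence4"
    and xz: "(x, z) \<in> R" and xt: "(x, t) \<in> R" and yt: "(y, t) \<in> R"
  shows "(y, z) \<in> R \<or> (x, y) \<in> R \<or> (z, t) \<in> R"
proof (rule ccontr)
  assume contra: "\<not> ((y, z) \<in> R \<or> (x, y) \<in> R \<or> (z, t) \<in> R)"
  have irr: "(a, a) \<notin> R" for a
    using R by (auto simp: strict_orders_def irrefl_def)
  have tr: "(a, b) \<in> R \<Longrightarrow> (b, c) \<in> R \<Longrightarrow> (a, c) \<in> R" for a b c
    using R by (auto simp: strict_orders_def dest: transD)
  have sub: "{x, z, y, t} \<subseteq> X"
    using R xz yt by (auto simp: strict_orders_def)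
  have dist: "distinct [x, z, y, t]"
    using irr contra xz xt yt by auto
  have neg: "(z, x) \<notin> R" "(z, y) \<notin> R" "(y, x) \<notin> R" "(t, x) \<notin> R" "(t, y) \<notin> R" "(t, z) \<notin> R"
    using irr contra xz xt yt tr by metis+
  have "([x, z, y, t] ! i, [x, z, y, t] ! j) \<in> R \<longleftrightarrow> (i, j) \<in> {(0, 1), (0, 3), (2, 3)}"
    if "i < 4" "j < 4" for i j :: nat
    using that neg irr contra xz xt yt by (auto simp: numeral_eq_Suc less_Suc_eq)
  from contains_subposet_iso_four[OF dist sub this] free show False
    by (simp add: fence4_def)
qed

theorem proposition4p3:
  fixes X :: "'a set" and R :: "'a rel" and n :: nat
  assumes "finite X" and "card X = n"
    and "R \<in> strict_orders X"
    and "\<not> contains_subposet_iso (X, R) two_plus_two"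
    and "\<not> contains_subposet_iso (X, R) fence4"
  shows "(X, R) \<in> catalan_posets n"
proof -
  have RX: "R \<subseteq> X \<times> X"
    using assms(3) by (auto simp: strict_orders_def)
  have irr: "(a, a) \<notin> R" for a
    using assms(3) by (auto simp: strict_orders_def irrefl_def)
  have tr: "(a, b) \<in> R \<Longrightarrow> (b, c) \<in> R \<Longrightarrow> (a, c) \<in> R" for a b c
    using assms(3) by (auto simp: strict_orders_def dest: transD)
  define up down where "up x = R `` {x}" and "down x = R\<inverse> `` {x}" for x
  have fin: "finite (up x)" "finite (down x)" for x
    using RX assms(1) by (auto simp: up_def down_def intro: finite_subset[of _ X])
  have up_nested: "up x \<subseteq> up y \<or> up y \<subseteq> up x" for x y
    using interval_order[OF assms(3,4)] by (auto simp: up_def)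
  have down_nested: "down x \<subseteq> down y \<or> down y \<subseteq> down x" for x y
    using interval_order[OF assms(3,4)] by (auto simp: down_def)
  have up_card: "up y \<subseteq> up x" if "card (up y) \<le> card (up x)" for x y
    using up_nested[of x y] card_seteq[OF fin(1) _ that] by auto
  have down_card: "down y \<subseteq> down x" if "card (down y) \<le> card (down x)" for x y
    using down_nested[of x y] card_seteq[OF fin(2) _ that] by auto
  obtain num :: "'a \<Rightarrow> nat" where num: "inj_on num X"
    using finite_imp_inj_to_nat_seg[OF assms(1)] by blast
  define key where "key x = (card (up x), card (down x), num x)" for x
  define L where "L = less_than <*lex*> less_than <*lex*> less_than"
  have L_trans: "trans L"
    unfolding L_def by (auto intro!: trans_lex_prod)
  have L_irrefl: "(key x, key x) \<notin> L" for x
    by (simp add: L_def key_def)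
  have L_total: "(key x, key y) \<in> L \<or> (key y, key x) \<in> L" if "x \<in> X" "y \<in> X" "x \<noteq> y" for x y
  proof -
    have "num x \<noteq> num y"
      using inj_onD[OF num] that by blast
    then show ?thesis
      by (auto simp: L_def key_def neq_iff)
  qed
  \<comment> \<open>Elements with a larger up-set have to come first, hence the reversed key comparison.\<close>
  define S where
    "S = {(x, y) \<in> X \<times> X. (x, y) \<notin> R \<and> (y, x) \<notin> R \<and> (key y, key x) \<in> L}"
  have up_mono: "up y \<subseteq> up x" if "(key y, key x) \<in> L" for x y
    using that by (intro up_card) (auto simp: L_def key_def)
  have S_trans: "(x, z) \<in> S" if xy: "(x, y) \<in> S" and yz: "(y, z) \<in> S" for x y z
  proof -
    have L: "(key y, key x) \<in> L" "(key z, key y) \<in> L" "(key z, key x) \<in> L"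
      using xy yz transD[OF L_trans, of "key z" "key y" "key x"] by (simp_all add: S_def)
    have "(z, x) \<notin> R"
      using up_mono[OF L(3)] irr by (auto simp: up_def)
    moreover have "(x, z) \<notin> R"
    proof
      assume xz: "(x, z) \<in> R"
      show False
      proof (cases "up y \<subseteq> up z")
        case True
        then have "card (up z) = card (up y)"
          using up_mono[OF L(2)] by (metis subset_antisym)
        then have "card (down z) \<le> card (down y)"
          using L(2) by (auto simp: L_def key_def)
        then have "(x, y) \<in> R"
          using down_card[of z y] xz by (auto simp: down_def)
        then show False
          using xy by (simp add: S_def)
      next
        case False
        then obtain t where t: "(y, t) \<in> R" "(z, t) \<notin> R"
          by (auto simp: up_def)
        have "(x, t) \<in> R"
          using up_mono[OF L(1)] t(1) by (auto simp: up_def)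
        from fence_free[OF assms(3,5) xz this t(1)] show False
          using t(2) xy yz by (auto simp: S_def)
      qed
    qed
    ultimately show ?thesis
      using xy yz L(3) by (auto simp: S_def)
  qed
  have "catalan_pair X S R"
    unfolding catalan_pair_def
  proof (intro conjI)
    show "S \<in> strict_orders X"
      unfolding strict_orders_def
    proof (intro CollectI conjI)
      show "S \<subseteq> X \<times> X"
        by (auto simp: S_def)
      show "irrefl S"
        using L_irrefl by (auto simp: irrefl_def S_def)
      show "trans S"
        using S_trans by (rule transI)
    qed
    show "R \<in> strict_orders X"
      by (rule assms(3))
    show "sym_closure R \<union> sym_closure S = X \<times> X - Id_on X"
      using RX irr L_total L_irrefl by (auto simp: sym_closure_def S_def)
    show "sym_closure R \<inter> sym_closure S = {}"
      by (auto simp: sym_closure_def S_def)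
    show "S O R \<subseteq> R"
      using up_mono by (auto simp: S_def up_def)
  qed
  then show ?thesis
    using assms(1,2) by (auto simp: catalan_posets_def)
qed

end
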